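(* For the global minima of the function $f_\alpha$ over $[0,1]$, we have the following three cases. (a) For $\alpha\in(-2,-1)$, the function $f_\alpha$ has a unique minimizer in $[0,1/2]$, which is located at $t=1/5$. Moreover, the minimum value is $$f_\alpha(1/5)=\frac{1+\alpha}{5(1-(\alpha/2)^2)}.$$ (b) For $\alpha=-1$, the minimum value of $f_\alpha$ is equal to $0$, and the set of minimizers is equal to the set of all $t\in[0,1]$ that have a Rademacher expansion $\boldsymbol\rho$ with $\rho_{2n}=\rho_{2n+1}$ for all $n\in\mathbb N_0$. This is a perfect set of Hausdorff dimension $1/2$, and its $1/2$-dimensional Hausdorff measure is finite and strictly positive. (c) For $\alpha\in(-1,2)$, the unique minimizer of $f_\alpha$ in $[0,1/2]$ is at $t=0$ and the minimum value is $f_\alpha(0)=0$.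
   Context: For $\alpha\in(-2,2)$, $f_\alpha(t)=\sum_{m=0}^\infty\frac{\alpha^m}{2^m}\phi(2^mt)$, $t\in[0,1]$, where $\phi(t)=\min_{z\in\mathbb Z}|t-z|$. Minimizers are points at which the global minimum over $[0,1]$ is attained. A $\{-1,+1\}$-valued sequence $\boldsymbol\rho=(\rho_n)_{n\in\mathbb N_0}$ is a Rademacher expansion of $t\in[0,1]$ if $t=\sum_{n=0}^\infty2^{-(n+2)}(1-\rho_n)$. A perfect set is a closed set without isolated points. *)

theory Defs
  imports "HOL-Analysis.Analysis"
begin

definition tent :: "real \<Rightarrow> real" where
  "tent t = (INF z::int. \<bar>t - of_int z\<bar>)"

lemma tent_attained: "\<exists>z::int. tent t = \<bar>t - of_int z\<bar> \<and> (\<forall>w::int. \<bar>t - of_int z\<bar> \<le> \<bar>t - of_int w\<bar>)"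
proof -
  have le: "\<bar>t - of_int (round t)\<bar> \<le> \<bar>t - of_int w\<bar>" for w :: int
    by (rule round_diff_minimal)
  have "tent t = \<bar>t - of_int (round t)\<bar>"
    unfolding tent_def by (rule cInf_eq_minimum) (use le in auto)
  with le show ?thesis by blast
qed

definition takagi :: "real \<Rightarrow> real \<Rightarrow> real" where
  "takagi \<alpha> t = (\<Sum>m. \<alpha> ^ m / 2 ^ m * tent (2 ^ m * t))"

lemma takagi_summable:
  assumes "\<alpha> \<in> {-2<..<2}"
  shows "summable (\<lambda>m. \<alpha> ^ m / 2 ^ m * tent (2 ^ m * t))"
proof (rule summable_comparison_test')
  show "summable (\<lambda>m. \<bar>\<alpha> / 2\<bar> ^ m)"
    using assms by (intro summable_geometric) auto
  have "\<bar>tent x\<bar> \<le> 1" for x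
  proof -
    obtain z :: int where z: "tent x = \<bar>x - of_int z\<bar>" "\<forall>w::int. \<bar>x - of_int z\<bar> \<le> \<bar>x - of_int w\<bar>"
      using tent_attained by blast
    have "\<bar>x - of_int z\<bar> \<le> \<bar>x - of_int \<lfloor>x\<rfloor>\<bar>" using z(2) by blast
    also have "\<dots> \<le> 1" by linarith
    finally show ?thesis using z(1) by simp
  qed
  then show "norm (\<alpha> ^ m / 2 ^ m * tent (2 ^ m * t)) \<le> \<bar>\<alpha> / 2\<bar> ^ m" for m
    by (simp add: abs_mult power_abs flip: power_divide) (simp add: mult_left_le)
qed

definition minimizers :: "('a \<Rightarrow> real) \<Rightarrow> 'a set \<Rightarrow> 'a set" where
  "minimizers f S = {t. is_arg_min f (\<lambda>s. s \<in> S) t}"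

definition is_minimum_value :: "('a \<Rightarrow> real) \<Rightarrow> 'a set \<Rightarrow> real \<Rightarrow> bool" where
  "is_minimum_value f S m \<longleftrightarrow> m \<in> f ` S \<and> (\<forall>s\<in>S. m \<le> f s)"

definition rademacher_expansion :: "(nat \<Rightarrow> real) \<Rightarrow> real \<Rightarrow> bool" where
  "rademacher_expansion \<rho> t \<longleftrightarrow>
     (\<forall>n. \<rho> n \<in> {-1, 1}) \<and> (\<lambda>n. (1 / 2 ^ (n + 2)) * (1 - \<rho> n)) sums t"

definition perfect_set :: "'a::topological_space set \<Rightarrow> bool" where
  "perfect_set S \<longleftrightarrow> closed S \<and> (\<forall>x. \<not> x isolated_in S)"

text \<open>
  The value $(\mathrm{diam}\,U)^s$ with the usual conventions that the empty set contributes $0$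
  and that $0^0 = 1$ for nonempty sets, which make the $0$-dimensional measure the counting
  measure (note that \<^term>\<open>0 powr 0 = (0::real)\<close>).
\<close>

definition diam_power :: "real \<Rightarrow> 'a::metric_space set \<Rightarrow> ennreal" where
  "diam_power s U =
     (if U = {} then 0 else if s = 0 then 1 else ennreal (diameter U powr s))"

text \<open>
  Boundedness of the covering sets is required explicitly because \<^const>\<open>diameter\<close> is $0$ on
  unbounded sets. Finite covers are included by padding with empty sets.
\<close>

definition hausdorff_premeasure :: "real \<Rightarrow> real \<Rightarrow> 'a::metric_space set \<Rightarrow> ennreal" where
  "hausdorff_premeasure s \<delta> A =
     (INF U \<in> {U :: nat \<Rightarrow> 'a set. (\<forall>i. bounded (U i) \<and> diameter (U i) \<le> \<delta>) \<and> A \<subseteq> (\<Union>i. U i)}.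
        \<Sum>i. diam_power s (U i))"

text \<open>
  The (outer) Hausdorff measure, without a normalizing factor.
\<close>

definition hausdorff_measure :: "real \<Rightarrow> 'a::metric_space set \<Rightarrow> ennreal" where
  "hausdorff_measure s A = (SUP \<delta> \<in> {0<..}. hausdorff_premeasure s \<delta> A)"

definition hausdorff_dim :: "'a::metric_space set \<Rightarrow> ennreal" where
  "hausdorff_dim A = (INF s \<in> {s. 0 \<le> s \<and> hausdorff_measure s A = 0}. ennreal s)"

end

theory Submission
  imports Defs
begin

text \<open>
  On a dyadic interval of order \<open>n\<close>, the partial sum of the first \<open>n\<close> terms is affine and the
  remainder is symmetric about the midpoint. Hence a minimizer lies in the left or right half
  according to whether the affine slope is positive or negative. For \<open>\<alpha> < -1\<close> the slope signs
  then force the binary digits of a minimizer in \<open>[0,1/2]\<close> one after another, which leaves only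
  \<open>1/5\<close>.

  For \<open>\<alpha> \<ge> -1\<close> the sum of two consecutive terms of the series is nonnegative, because
  \<open>tent (2x) \<le> 2 tent x\<close>. For \<open>\<alpha> = -1\<close> it vanishes iff \<open>tent x \<le> 1/4\<close>, so the zeros are the
  points whose base-4 digits can be chosen in \<open>{0,3}\<close>. The upper bound for the Hausdorff measure of
  this Cantor set is the covering by \<open>2 ^ n\<close> intervals of length \<open>4 ^ -n\<close>; the lower bound follows
  because the Cantor function is Hoelder continuous of exponent \<open>1/2\<close> and maps onto \<open>[0,1]\<close>.
\<close>

section \<open>The tent function\<close>

lemma tent_le: "tent x \<le> \<bar>x - of_int z\<bar>"
  using tent_attained[of x] by fastforce

lemma tent_nonneg: "0 \<le> tent x"
  using tent_attained[of x] by fastforce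

lemma tent_obtain:
  obtains z :: int where "tent x = \<bar>x - of_int z\<bar>" "\<bar>x - of_int z\<bar> \<le> 1/2"
proof -
  obtain z :: int where z: "tent x = \<bar>x - of_int z\<bar>"
      "\<And>w::int. \<bar>x - of_int z\<bar> \<le> \<bar>x - of_int w\<bar>"
    using tent_attained by blast
  have "\<bar>x - of_int z\<bar> \<le> \<bar>x - of_int (round x)\<bar>" by (rule z(2))
  also have "\<dots> \<le> 1/2" using of_int_round_abs_le[of x] by linarith
  finally show thesis using z(1) that by blast
qed

lemma tent_le_half: "tent x \<le> 1/2"
  using tent_obtain[of x] by metis

text \<open>Distinct integers are at least 1 apart, so two integers within 1/2 of \<open>x\<close>
  agree or tie. Any such integer therefore evaluates \<open>tent\<close>.\<close>

lemma tent_eq: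
  assumes "\<bar>x - of_int z\<bar> \<le> 1/2"
  shows "tent x = \<bar>x - of_int z\<bar>"
proof -
  obtain w :: int where w: "tent x = \<bar>x - of_int w\<bar>" "\<bar>x - of_int w\<bar> \<le> 1/2"
    by (rule tent_obtain)
  have "w = z \<or> real_of_int w + 1 \<le> of_int z \<or> real_of_int z + 1 \<le> of_int w"
    by linarith
  then show ?thesis using w assms by (elim disjE) linarith+
qed

lemma tent_eq_self: "0 \<le> x \<Longrightarrow> x \<le> 1/2 \<Longrightarrow> tent x = x"
  using tent_eq[of x 0] by simp

lemma tent_add_int: "tent (x + of_int k) = tent x"
proof -
  obtain z :: int where z: "tent x = \<bar>x - of_int z\<bar>" "\<bar>x - of_int z\<bar> \<le> 1/2"
    by (rule tent_obtain)
  then show ?thesis using tent_eq[of "x + of_int k" "z + k"] by simp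
qed

lemma tent_minus: "tent (- x) = tent x"
proof -
  obtain z :: int where z: "tent x = \<bar>x - of_int z\<bar>" "\<bar>x - of_int z\<bar> \<le> 1/2"
    by (rule tent_obtain)
  then show ?thesis using tent_eq[of "- x" "- z"] by (simp add: abs_minus_commute)
qed

text \<open>Doubling acts on the distance to the integers as the tent map, so two consecutive terms
  of the series depend on \<open>tent x\<close> alone.\<close>

lemma tent_double: "tent (2 * x) = min (2 * tent x) (1 - 2 * tent x)"
proof -
  obtain z :: int where z: "tent x = \<bar>x - of_int z\<bar>" "\<bar>x - of_int z\<bar> \<le> 1/2"
    by (rule tent_obtain)
  consider "\<bar>x - of_int z\<bar> \<le> 1/4" | "x - of_int z > 1/4" | "x - of_int z < -1/4"
    by linarith
  then show ?thesis
  proof cases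
    case 1
    then have "tent (2 * x) = \<bar>2 * x - of_int (2 * z)\<bar>" by (intro tent_eq) (simp add: abs_if split: if_splits)
    with 1 z show ?thesis by (simp add: abs_if split: if_splits)
  next
    case 2
    then have "tent (2 * x) = \<bar>2 * x - of_int (2 * z + 1)\<bar>"
      using z by (intro tent_eq) (simp add: abs_if split: if_splits)
    with 2 z show ?thesis by simp
  next
    case 3
    then have "tent (2 * x) = \<bar>2 * x - of_int (2 * z - 1)\<bar>"
      using z by (intro tent_eq) (simp add: abs_if split: if_splits)
    with 3 z show ?thesis by simp
  qed
qed

lemma tent_diff_le: "\<bar>tent x - tent y\<bar> \<le> \<bar>x - y\<bar>"
proof -
  obtain z w :: int where "tent x = \<bar>x - of_int z\<bar>" "tent y = \<bar>y - of_int w\<bar>"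
    using tent_obtain[of x] tent_obtain[of y] by metis
  with tent_le[of x w] tent_le[of y z] show ?thesis by linarith
qed

lemma continuous_on_tent: "continuous_on UNIV tent"
proof (rule continuous_onI)
  fix x e :: real assume "0 < e"
  moreover have "dist (tent y) (tent x) \<le> dist y x" for y
    using tent_diff_le by (simp add: dist_real_def)
  ultimately show "\<exists>d>0. \<forall>x'\<in>UNIV. dist x' x < d \<longrightarrow> dist (tent x') (tent x) \<le> e"
    by (meson less_imp_le order_trans)
qed

section \<open>Functional equations and continuity\<close>

lemma takagi_rec:
  assumes "\<alpha> \<in> {-2<..<2}"
  shows "takagi \<alpha> t = tent t + \<alpha> / 2 * takagi \<alpha> (2 * t)"
proof -
  have "takagi \<alpha> t - tent t = (\<Sum>m. \<alpha> ^ Suc m / 2 ^ Suc m * tent (2 ^ Suc m * t))"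
    unfolding takagi_def by (subst suminf_split_head[OF takagi_summable[OF assms]]) simp
  also have "\<dots> = (\<Sum>m. \<alpha> / 2 * (\<alpha> ^ m / 2 ^ m * tent (2 ^ m * (2 * t))))"
    by (simp add: mult_ac)
  also have "\<dots> = \<alpha> / 2 * takagi \<alpha> (2 * t)"
    unfolding takagi_def by (rule suminf_mult[OF takagi_summable[OF assms]])
  finally show ?thesis by simp
qed

lemma takagi_add_int: "takagi \<alpha> (t + of_int k) = takagi \<alpha> t"
proof -
  have "tent (2 ^ m * (t + of_int k)) = tent (2 ^ m * t)" for m
    using tent_add_int[of "2 ^ m * t" "2 ^ m * k"] by (simp add: distrib_left)
  then show ?thesis by (simp add: takagi_def)
qed

lemma takagi_minus: "takagi \<alpha> (- t) = takagi \<alpha> t"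
  using tent_minus by (simp add: takagi_def)

lemma takagi_reflect: "takagi \<alpha> (1 - t) = takagi \<alpha> t"
  using takagi_add_int[of \<alpha> "- t" 1] by (simp add: takagi_minus)

text \<open>Weierstrass M-test with a geometric majorant. Continuity is needed for the existence of
  minimizers and for closedness of the zero set.\<close>

lemma continuous_on_takagi:
  assumes "\<alpha> \<in> {-2<..<2}"
  shows "continuous_on UNIV (takagi \<alpha>)"
proof -
  have bound: "norm (\<alpha> ^ m / 2 ^ m * tent (2 ^ m * t)) \<le> \<bar>\<alpha> / 2\<bar> ^ m" for m t
  proof -
    have "\<bar>tent (2 ^ m * t)\<bar> \<le> 1"
      using tent_nonneg[of "2 ^ m * t"] tent_le_half[of "2 ^ m * t"] by simp
    then have "\<bar>\<alpha> / 2\<bar> ^ m * \<bar>tent (2 ^ m * t)\<bar> \<le> \<bar>\<alpha> / 2\<bar> ^ m"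
      by (intro mult_left_le) auto
    then show ?thesis by (simp add: abs_mult power_abs power_divide)
  qed
  have unif: "uniform_limit UNIV (\<lambda>n t. \<Sum>m<n. \<alpha> ^ m / 2 ^ m * tent (2 ^ m * t))
      (\<lambda>t. \<Sum>m. \<alpha> ^ m / 2 ^ m * tent (2 ^ m * t)) sequentially"
    by (rule Weierstrass_m_test[OF bound]) (use assms in \<open>auto intro: summable_geometric\<close>)
  have "continuous_on UNIV (\<lambda>t. tent (c * t))" for c
    by (rule continuous_on_compose2[OF continuous_on_tent]) (auto intro: continuous_intros)
  then have "continuous_on UNIV (\<lambda>t. \<Sum>m. \<alpha> ^ m / 2 ^ m * tent (2 ^ m * t))"
    by (intro uniform_limit_theorem[OF _ unif] always_eventually allI continuous_intros) auto
  then show ?thesis by (simp add: takagi_def[abs_def])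
qed

lemma takagi_minimum_attained:
  assumes "\<alpha> \<in> {-2<..<2}"
  obtains m where "m \<in> {0..1/2}" "\<And>s. s \<in> {0..1} \<Longrightarrow> takagi \<alpha> m \<le> takagi \<alpha> s"
proof -
  have "\<exists>m\<in>{0..1::real}. \<forall>s\<in>{0..1}. takagi \<alpha> m \<le> takagi \<alpha> s"
    using continuous_on_subset[OF continuous_on_takagi[OF assms]]
    by (intro continuous_attains_inf) auto
  then obtain m where m: "m \<in> {0..1}" "\<And>s. s \<in> {0..1} \<Longrightarrow> takagi \<alpha> m \<le> takagi \<alpha> s"
    by blast
  show thesis
  proof (cases "m \<le> 1/2")
    case True
    with m that show ?thesis by auto
  next
    case False
    with m that[of "1 - m"] takagi_reflect show ?thesis by auto
  qed
qed

lemma mem_minimizers_iff: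
  fixes f :: "'a \<Rightarrow> real"
  shows "t \<in> minimizers f S \<longleftrightarrow> t \<in> S \<and> (\<forall>s\<in>S. f t \<le> f s)"
  by (auto simp: minimizers_def is_arg_min_linorder)

section \<open>The case \<open>\<alpha> < -1\<close>\<close>

text \<open>Up to scaling and an additive constant, \<open>s * y + c * takagi \<alpha> y\<close> is \<open>takagi \<alpha>\<close> on a dyadic interval,
  with \<open>y\<close> the position within the interval.\<close>

definition tilted_min :: "real \<Rightarrow> real \<Rightarrow> real \<Rightarrow> real \<Rightarrow> bool" where
  "tilted_min \<alpha> s c x \<longleftrightarrow> x \<in> {0..1} \<and>
     (\<forall>y\<in>{0..1}. s * x + c * takagi \<alpha> x \<le> s * y + c * takagi \<alpha> y)"

text \<open>The mirror image \<open>1 - x\<close> has the same \<open>takagi\<close> value, so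
  comparing with it leaves only the affine part.\<close>

lemma tilted_min_left_half:
  assumes "tilted_min \<alpha> s c x" "s > 0"
  shows "x \<le> 1/2"
proof -
  have "s * x + c * takagi \<alpha> x \<le> s * (1 - x) + c * takagi \<alpha> (1 - x)"
    using assms(1) unfolding tilted_min_def by (auto elim!: ballE[of _ _ "1 - x"])
  then have "s * x \<le> s * (1 - x)" by (simp add: takagi_reflect)
  then show ?thesis using \<open>s > 0\<close> by simp
qed

lemma tilted_min_right_half:
  assumes "tilted_min \<alpha> s c x" "s < 0"
  shows "1/2 \<le> x"
proof -
  have "s * x + c * takagi \<alpha> x \<le> s * (1 - x) + c * takagi \<alpha> (1 - x)"
    using assms(1) unfolding tilted_min_def by (auto elim!: ballE[of _ _ "1 - x"])
  then have "s * x \<le> s * (1 - x)" by (simp add: takagi_reflect)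
  then show ?thesis using \<open>s < 0\<close> by simp
qed

lemma takagi_left_half:
  assumes "\<alpha> \<in> {-2<..<2}" "y \<in> {0..1}"
  shows "takagi \<alpha> (y / 2) = y / 2 + \<alpha> / 2 * takagi \<alpha> y"
  using assms takagi_rec[of \<alpha> "y / 2"] tent_eq_self[of "y / 2"] by simp

text \<open>Substituting \<open>y / 2\<close> turns twice the objective into one of the same form:
  the first term of the series adds \<open>c\<close> to the slope, and the recursion multiplies the
  weight by \<alpha>.\<close>

lemma tilted_min_zoom_left:
  assumes \<alpha>: "\<alpha> \<in> {-2<..<2}" and min: "tilted_min \<alpha> s c x" and "s > 0"
  shows "tilted_min \<alpha> (s + c) (c * \<alpha>) (2 * x)"
proof -
  have zoom: "2 * (s * (y / 2) + c * takagi \<alpha> (y / 2)) = (s + c) * y + c * \<alpha> * takagi \<alpha> y"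
    if "y \<in> {0..1}" for y
    using takagi_left_half[OF \<alpha> that] by (simp add: algebra_simps)
  have x: "2 * x \<in> {0..1}"
    using tilted_min_left_half[OF min \<open>s > 0\<close>] min by (simp add: tilted_min_def)
  have "(s + c) * (2 * x) + c * \<alpha> * takagi \<alpha> (2 * x) \<le> (s + c) * y + c * \<alpha> * takagi \<alpha> y"
    if y: "y \<in> {0..1}" for y
  proof -
    have "y / 2 \<in> {0..1}" using y by auto
    then have "s * x + c * takagi \<alpha> x \<le> s * (y / 2) + c * takagi \<alpha> (y / 2)"
      using min unfolding tilted_min_def by blast
    then show ?thesis using zoom[OF y] zoom[OF x] by simp
  qed
  with x show ?thesis by (simp add: tilted_min_def)
qed

text \<open>On the right half the tent descends, so the slope changes by \<open>- c\<close>; the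
  additive constant \<open>s + c\<close> does not affect minimality.\<close>

lemma tilted_min_zoom_right:
  assumes \<alpha>: "\<alpha> \<in> {-2<..<2}" and min: "tilted_min \<alpha> s c x" and "s < 0"
  shows "tilted_min \<alpha> (s - c) (c * \<alpha>) (2 * x - 1)"
proof -
  have zoom: "2 * (s * ((y + 1) / 2) + c * takagi \<alpha> ((y + 1) / 2)) =
      (s - c) * y + c * \<alpha> * takagi \<alpha> y + (s + c)"
    if y: "y \<in> {0..1}" for y
  proof -
    have "takagi \<alpha> ((y + 1) / 2) = takagi \<alpha> ((1 - y) / 2)"
      using takagi_reflect[of \<alpha> "(y + 1) / 2"] by (simp add: field_simps)
    also have "\<dots> = (1 - y) / 2 + \<alpha> / 2 * takagi \<alpha> y"
      using takagi_left_half[OF \<alpha>, of "1 - y"] y by (simp add: takagi_reflect)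
    finally have eq: "takagi \<alpha> ((y + 1) / 2) = (1 - y) / 2 + \<alpha> / 2 * takagi \<alpha> y" .
    show ?thesis unfolding eq by (simp add: field_simps)
  qed
  have x: "2 * x - 1 \<in> {0..1}"
    using tilted_min_right_half[OF min \<open>s < 0\<close>] min by (simp add: tilted_min_def)
  have "(s - c) * (2 * x - 1) + c * \<alpha> * takagi \<alpha> (2 * x - 1) \<le> (s - c) * y + c * \<alpha> * takagi \<alpha> y"
    if y: "y \<in> {0..1}" for y
  proof -
    have "(y + 1) / 2 \<in> {0..1}" using y by auto
    then have "s * x + c * takagi \<alpha> x \<le> s * ((y + 1) / 2) + c * takagi \<alpha> ((y + 1) / 2)"
      using min unfolding tilted_min_def by blast
    then show ?thesis using zoom[OF y] zoom[OF x] by simp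
  qed
  with x show ?thesis by (simp add: tilted_min_def)
qed

lemma tilted_min_scale:
  assumes "tilted_min \<alpha> (k * s) (k * c) x" "k > 0"
  shows "tilted_min \<alpha> s c x"
proof -
  have "k * (s * x + c * takagi \<alpha> x) \<le> k * (s * y + c * takagi \<alpha> y)" if "y \<in> {0..1}" for y
    using assms(1) that by (simp add: tilted_min_def distrib_left mult.assoc)
  then show ?thesis using assms by (simp add: tilted_min_def)
qed

text \<open>The range \<open>1 \<le> \<sigma> < -\<alpha>\<close> of normalized slopes is invariant: four halvings trace the period \<open>0110\<close> of the binary expansion
  of \<open>2/5\<close>.\<close>

lemma tilted_min_period:
  assumes \<alpha>: "\<alpha> \<in> {-2<..<-1}" and \<sigma>: "1 \<le> \<sigma>" "\<sigma> < - \<alpha>" and min: "tilted_min \<alpha> \<sigma> \<alpha> x"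
  obtains \<sigma>' where "1 \<le> \<sigma>'" "\<sigma>' < - \<alpha>" "tilted_min \<alpha> \<sigma>' \<alpha> (16 * x - 6)"
proof -
  define a where "a = - \<alpha>"
  have a: "1 < a" "a < 2" and \<alpha>': "\<alpha> \<in> {-2<..<2}" using \<alpha> by (auto simp: a_def)
  have sq: "a < a ^ 2" using a by (simp add: power2_eq_square)
  \<comment> \<open>For \<sigma> = 1 this is the slope after three halvings.\<close>
  have pos: "1 - a - a ^ 2 + a ^ 3 > 0"
  proof -
    have "1 - a - a ^ 2 + a ^ 3 = (a - 1) * (a ^ 2 - 1)" by (simp add: field_simps power_numeral_reduce)
    with a sq show ?thesis by simp
  qed
  \<comment> \<open>The slope is positive at the start, then negative, negative and positive; the
    zooms go left, right, right, left.\<close>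
  have s1: "\<sigma> + \<alpha> < 0" using \<sigma> by simp
  have s2: "\<sigma> + \<alpha> - \<alpha> * \<alpha> < 0" using s1 by (smt (verit) zero_le_square)
  have s3: "\<sigma> + \<alpha> - \<alpha> * \<alpha> - \<alpha> * \<alpha> * \<alpha> > 0"
    using pos \<sigma> by (simp add: a_def power_numeral_reduce mult.assoc)
  have m1: "tilted_min \<alpha> (\<sigma> + \<alpha>) (\<alpha> * \<alpha>) (2 * x)"
    using tilted_min_zoom_left[OF \<alpha>' min] \<sigma> by simp
  have m2: "tilted_min \<alpha> (\<sigma> + \<alpha> - \<alpha> * \<alpha>) (\<alpha> * \<alpha> * \<alpha>) (2 * (2 * x) - 1)"
    by (rule tilted_min_zoom_right[OF \<alpha>' m1 s1])
  have m3: "tilted_min \<alpha> (\<sigma> + \<alpha> - \<alpha> * \<alpha> - \<alpha> * \<alpha> * \<alpha>) (\<alpha> * \<alpha> * \<alpha> * \<alpha>) (2 * (2 * (2 * x) - 1) - 1)"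
    by (rule tilted_min_zoom_right[OF \<alpha>' m2 s2])
  have m4: "tilted_min \<alpha> (\<sigma> + \<alpha> - \<alpha> * \<alpha> - \<alpha> * \<alpha> * \<alpha> + \<alpha> * \<alpha> * \<alpha> * \<alpha>) (\<alpha> * \<alpha> * \<alpha> * \<alpha> * \<alpha>)
      (2 * (2 * (2 * (2 * x) - 1) - 1))"
    by (rule tilted_min_zoom_left[OF \<alpha>' m3 s3])
  \<comment> \<open>\<open>q\<close> is the slope after three halvings. The fourth adds
    \<open>a ^ 4\<close>, and dividing by \<open>a ^ 4\<close> restores the weight \<alpha>.\<close>
  define q where "q = \<sigma> - a - a ^ 2 + a ^ 3"
  define \<sigma>' where "\<sigma>' = 1 + q / a ^ 4"
  have a4: "a ^ 4 > 0" using a by simp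
  have slope: "\<sigma> + \<alpha> - \<alpha> * \<alpha> - \<alpha> * \<alpha> * \<alpha> + \<alpha> * \<alpha> * \<alpha> * \<alpha> = a ^ 4 * \<sigma>'"
  proof -
    have "a ^ 4 * \<sigma>' = a ^ 4 + q" using a4 by (simp add: \<sigma>'_def distrib_left)
    then show ?thesis by (simp add: q_def a_def power_numeral_reduce mult.assoc)
  qed
  have weight: "\<alpha> * \<alpha> * \<alpha> * \<alpha> * \<alpha> = a ^ 4 * \<alpha>"
    by (simp add: a_def power_numeral_reduce)
  have "tilted_min \<alpha> \<sigma>' \<alpha> (2 * (2 * (2 * (2 * x) - 1) - 1))"
    using m4 unfolding slope weight by (rule tilted_min_scale) (rule a4)
  then have "tilted_min \<alpha> \<sigma>' \<alpha> (16 * x - 6)" by (simp add: algebra_simps)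
  moreover have "1 \<le> \<sigma>'" using pos \<sigma> a4 by (simp add: \<sigma>'_def q_def)
  moreover have "\<sigma>' < - \<alpha>"
  proof -
    have "q < a ^ 3 - a ^ 2" using \<sigma> by (simp add: q_def a_def)
    also have "\<dots> = a ^ 2 * (a - 1)" by (simp add: power_numeral_reduce algebra_simps)
    also have "\<dots> \<le> a ^ 4 * (a - 1)"
      using a by (intro mult_right_mono power_increasing) auto
    finally have "q / a ^ 4 < a - 1" using a4 by (simp add: divide_less_eq mult.commute)
    then show ?thesis by (simp add: \<sigma>'_def a_def)
  qed
  ultimately show thesis using that by blast
qed

text \<open>The map \<open>16 * x - 6\<close> fixes 2/5 and expands distances by 16, yet all
  iterates stay in the unit interval. This forces distance 0.\<close>

lemma tilted_min_unique:
  assumes \<alpha>: "\<alpha> \<in> {-2<..<-1}" and "1 \<le> \<sigma>" "\<sigma> < - \<alpha>" "tilted_min \<alpha> \<sigma> \<alpha> x"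
  shows "x = 2/5"
proof -
  have bound: "\<bar>x - 2/5\<bar> \<le> (1/16) ^ n"
    if "1 \<le> \<sigma>" "\<sigma> < - \<alpha>" "tilted_min \<alpha> \<sigma> \<alpha> x" for n \<sigma> x
    using that
  proof (induction n arbitrary: \<sigma> x)
    case 0
    then show ?case by (auto simp: tilted_min_def)
  next
    case (Suc n)
    obtain \<sigma>' where "1 \<le> \<sigma>'" "\<sigma>' < - \<alpha>" "tilted_min \<alpha> \<sigma>' \<alpha> (16 * x - 6)"
      using tilted_min_period[OF \<alpha> Suc.prems] by blast
    then have "\<bar>16 * x - 6 - 2/5\<bar> \<le> (1/16) ^ n" by (rule Suc.IH)
    moreover have "16 * x - 6 - 2/5 = 16 * (x - 2/5)" by simp
    ultimately show ?case by (simp only: abs_mult) simp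
  qed
  have "(\<lambda>n. (1/16::real) ^ n) \<longlonglongrightarrow> 0" by (rule LIMSEQ_power_zero) simp
  then have "\<bar>x - 2/5\<bar> \<le> 0"
    by (rule LIMSEQ_le_const) (use bound[OF assms(2-4)] in blast)
  then show ?thesis by simp
qed

text \<open>The initial slope is 0 and decides nothing, so the first halving comes from
  \<open>t \<le> 1/2\<close>. It produces the slope 1, the lower end of the invariant range.\<close>

lemma takagi_minimizer_eq_fifth:
  assumes \<alpha>: "\<alpha> \<in> {-2<..<-1}" and t: "t \<in> {0..1/2}"
    and min: "\<And>s. s \<in> {0..1} \<Longrightarrow> takagi \<alpha> t \<le> takagi \<alpha> s"
  shows "t = 1/5"
proof -
  have \<alpha>': "\<alpha> \<in> {-2<..<2}" using \<alpha> by auto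
  have half: "2 * takagi \<alpha> (y / 2) = 1 * y + \<alpha> * takagi \<alpha> y" if "y \<in> {0..1}" for y
    using takagi_left_half[OF \<alpha>' that] by simp
  have "1 * (2 * t) + \<alpha> * takagi \<alpha> (2 * t) \<le> 1 * y + \<alpha> * takagi \<alpha> y" if y: "y \<in> {0..1}" for y
    using half[OF y] half[of "2 * t"] t min[of "y / 2"] y by simp
  with t have "tilted_min \<alpha> 1 \<alpha> (2 * t)" by (simp add: tilted_min_def)
  then have "2 * t = 2/5" using \<alpha> by (intro tilted_min_unique[of \<alpha> 1]) auto
  then show ?thesis by simp
qed

text \<open>Doubling sends 1/5 to 2/5 and then to 4/5, which reflects back to 1/5. Two uses of the
  recursion thus give a linear equation for the value.\<close>

lemma takagi_fifth:
  assumes "\<alpha> \<in> {-2<..<2}"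
  shows "takagi \<alpha> (1/5) = (1 + \<alpha>) / (5 * (1 - (\<alpha> / 2)\<^sup>2))"
proof -
  have "takagi \<alpha> (4/5) = takagi \<alpha> (1/5)" using takagi_reflect[of \<alpha> "1/5"] by simp
  then have "takagi \<alpha> (1/5) = 1/5 + \<alpha> / 2 * (2/5 + \<alpha> / 2 * takagi \<alpha> (1/5))"
    using takagi_rec[OF assms, of "1/5"] takagi_rec[OF assms, of "2/5"]
      tent_eq_self[of "1/5"] tent_eq_self[of "2/5"] by simp
  then have "takagi \<alpha> (1/5) * (5 * (1 - (\<alpha> / 2)\<^sup>2)) = 1 + \<alpha>"
    by (simp add: power2_eq_square algebra_simps)
  moreover have "(\<alpha> / 2)\<^sup>2 < 1"
    using assms by (intro abs_square_less_1[THEN iffD2]) auto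
  ultimately show ?thesis by (simp add: eq_divide_eq)
qed

section \<open>Grouping the series in pairs\<close>

definition pair_term :: "real \<Rightarrow> real \<Rightarrow> real" where
  "pair_term \<alpha> x = tent x + \<alpha> / 2 * tent (2 * x)"

text \<open>Starting each pair at an even index makes the scaling factor nonnegative even for
  negative \<alpha>.\<close>

lemma takagi_pairs:
  assumes "\<alpha> \<in> {-2<..<2}"
  shows "(\<lambda>k. (\<alpha>\<^sup>2 / 4) ^ k * pair_term \<alpha> (4 ^ k * t)) sums takagi \<alpha> t"
proof -
  let ?f = "\<lambda>m. \<alpha> ^ m / 2 ^ m * tent (2 ^ m * t)"
  have "?f sums takagi \<alpha> t"
    using summable_sums[OF takagi_summable[OF assms]] by (simp add: takagi_def)
  then have "(\<lambda>k. sum ?f {k * 2..<k * 2 + 2}) sums takagi \<alpha> t" by (rule sums_group) simp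
  moreover have "sum ?f {k * 2..<k * 2 + 2} = (\<alpha>\<^sup>2 / 4) ^ k * pair_term \<alpha> (4 ^ k * t)" for k
  proof -
    have "sum ?f {k * 2..<k * 2 + 2} = ?f (2 * k) + ?f (Suc (2 * k))"
      by (simp add: numeral_2_eq_2 mult.commute)
    then show ?thesis
      by (simp add: pair_term_def power_mult power_divide power2_eq_square distrib_left
          mult_ac flip: power_mult_distrib)
  qed
  ultimately show ?thesis by simp
qed

text \<open>For \<alpha> < 0, \<open>tent (2 * x) \<le> 2 * tent x\<close> reverses under the
  negative factor. The constant is positive for \<alpha> > -1 and drops to 0 at -1, which separates
  the last two cases of the theorem.\<close>

lemma pair_term_lower_bound:
  assumes "-1 \<le> \<alpha>"
  shows "min 1 (1 + \<alpha>) * tent x \<le> pair_term \<alpha> x"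
proof (cases "\<alpha> \<ge> 0")
  case True
  then have "0 \<le> \<alpha> / 2 * tent (2 * x)" by (simp add: tent_nonneg)
  then show ?thesis using True by (simp add: pair_term_def)
next
  case False
  have "tent (2 * x) \<le> 2 * tent x" by (simp add: tent_double)
  then have "\<alpha> / 2 * (2 * tent x) \<le> \<alpha> / 2 * tent (2 * x)"
    using False by (intro mult_left_mono_neg) auto
  then show ?thesis using False by (simp add: pair_term_def algebra_simps)
qed

lemma pair_term_nonneg: "-1 \<le> \<alpha> \<Longrightarrow> 0 \<le> pair_term \<alpha> x"
  using pair_term_lower_bound[of \<alpha> x] tent_nonneg[of x]
  by (smt (verit) mult_nonneg_nonneg)

lemma pair_term_le_takagi:
  assumes "\<alpha> \<in> {-1..<2}"
  shows "pair_term \<alpha> t \<le> takagi \<alpha> t"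
proof -
  have sums: "(\<lambda>k. (\<alpha>\<^sup>2 / 4) ^ k * pair_term \<alpha> (4 ^ k * t)) sums takagi \<alpha> t"
    using assms by (intro takagi_pairs) auto
  have "sum (\<lambda>k. (\<alpha>\<^sup>2 / 4) ^ k * pair_term \<alpha> (4 ^ k * t)) {0} \<le> takagi \<alpha> t"
    unfolding sums_unique[OF sums]
    using assms by (intro sum_le_suminf sums_summable[OF sums] mult_nonneg_nonneg pair_term_nonneg) auto
  then show ?thesis by simp
qed

lemma takagi_0: "takagi \<alpha> 0 = 0"
  using tent_eq_self[of 0] by (simp add: takagi_def)

lemma takagi_nonneg: "\<alpha> \<in> {-1..<2} \<Longrightarrow> 0 \<le> takagi \<alpha> t"
  using pair_term_le_takagi[of \<alpha> t] pair_term_nonneg[of \<alpha> t] by simp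

lemma takagi_pos:
  assumes "\<alpha> \<in> {-1<..<2}" "0 < t" "t \<le> 1/2"
  shows "0 < takagi \<alpha> t"
proof -
  have "0 < min 1 (1 + \<alpha>) * tent t" using assms tent_eq_self[of t] by simp
  also have "\<dots> \<le> pair_term \<alpha> t" using assms by (intro pair_term_lower_bound) auto
  also have "\<dots> \<le> takagi \<alpha> t" using assms by (intro pair_term_le_takagi) auto
  finally show ?thesis .
qed

lemma takagi_minus_one_eq_0_iff:
  "takagi (-1) t = 0 \<longleftrightarrow> (\<forall>k. tent (4 ^ k * t) \<le> 1/4)"
proof -
  \<comment> \<open>If \<open>tent x\<close> exceeds 1/4, the pair term is
    \<open>2 * tent x - 1/2\<close>, hence positive.\<close>
  have pair_term_eq_0: "pair_term (-1) x = 0 \<longleftrightarrow> tent x \<le> 1/4" for x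
    by (cases "tent x \<le> 1/4") (simp_all add: pair_term_def tent_double min_def)
  have sums: "(\<lambda>k. ((-1)\<^sup>2 / 4) ^ k * pair_term (-1) (4 ^ k * t)) sums takagi (-1) t"
    by (rule takagi_pairs) simp
  have "takagi (-1) t = 0 \<longleftrightarrow> (\<forall>k. ((-1)\<^sup>2 / 4) ^ k * pair_term (-1) (4 ^ k * t) = 0)"
    unfolding sums_unique[OF sums]
    by (intro suminf_eq_zero_iff sums_summable[OF sums] mult_nonneg_nonneg pair_term_nonneg) auto
  also have "\<dots> \<longleftrightarrow> (\<forall>k. pair_term (-1) (4 ^ k * t) = 0)" by simp
  also have "\<dots> \<longleftrightarrow> (\<forall>k. tent (4 ^ k * t) \<le> 1/4)"
    by (simp add: pair_term_eq_0)
  finally show ?thesis .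
qed

section \<open>Expansions with extreme digits\<close>

text \<open>The digits are 0 or \<open>q - 1\<close>, encoded as booleans, so one sequence can be
  read in base 4 as a point of the Cantor set and in base 2 as the value of the Cantor function
  there.\<close>

definition digit_val :: "real \<Rightarrow> (nat \<Rightarrow> bool) \<Rightarrow> real" where
  "digit_val q d = (\<Sum>n. (q - 1) * of_bool (d n) / q ^ Suc n)"

lemma geometric_digit_sums:
  fixes q :: real
  assumes "q > 1"
  shows "(\<lambda>n. (q - 1) / q ^ Suc n) sums 1"
proof -
  have "(\<lambda>n. (q - 1) / q * (1 / q) ^ n) sums ((q - 1) / q * (1 / (1 - 1 / q)))"
    using assms by (intro sums_mult geometric_sums) simp
  moreover have "(q - 1) / q * (1 / (1 - 1 / q)) = 1"
    using assms by (simp add: field_simps)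
  moreover have "(q - 1) / q * (1 / q) ^ n = (q - 1) / q ^ Suc n" for n
    by (simp add: power_divide)
  ultimately show ?thesis by (simp only:)
qed

lemma digit_val_summable:
  fixes q :: real
  assumes "q > 1"
  shows "summable (\<lambda>n. (q - 1) * of_bool (d n) / q ^ Suc n)"
proof (rule summable_comparison_test')
  show "summable (\<lambda>n. (q - 1) / q ^ Suc n)"
    using sums_summable[OF geometric_digit_sums[OF assms]] .
  show "norm ((q - 1) * of_bool (d n) / q ^ Suc n) \<le> (q - 1) / q ^ Suc n" for n
    using assms by (cases "d n") auto
qed

lemma digit_val_nonneg: "q > 1 \<Longrightarrow> 0 \<le> digit_val q d"
  unfolding digit_val_def by (intro suminf_nonneg digit_val_summable) auto

lemma digit_val_le_1:
  assumes "q > 1"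
  shows "digit_val q d \<le> 1"
proof -
  have "digit_val q d \<le> (\<Sum>n. (q - 1) / q ^ Suc n)"
    unfolding digit_val_def using assms
    by (intro suminf_le digit_val_summable sums_summable[OF geometric_digit_sums])
       (auto intro!: divide_right_mono)
  also have "\<dots> = 1" using sums_unique[OF geometric_digit_sums[OF assms]] by simp
  finally show ?thesis .
qed

text \<open>Self-similarity: the values arise from the two contractions \<open>y / q\<close> and
  \<open>(q - 1 + y) / q\<close>.\<close>

lemma digit_val_head:
  assumes "q > 1"
  shows "digit_val q d = ((q - 1) * of_bool (d 0) + digit_val q (\<lambda>n. d (Suc n))) / q"
proof -
  have "digit_val q d - (q - 1) * of_bool (d 0) / q =
      (\<Sum>n. (q - 1) * of_bool (d (Suc n)) / q ^ Suc (Suc n))"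
    unfolding digit_val_def by (subst suminf_split_head[OF digit_val_summable[OF assms]]) simp
  also have "\<dots> = (\<Sum>n. ((q - 1) * of_bool (d (Suc n)) / q ^ Suc n) / q)"
    by (simp add: mult_ac)
  also have "\<dots> = digit_val q (\<lambda>n. d (Suc n)) / q"
    unfolding digit_val_def by (rule suminf_divide[OF digit_val_summable[OF assms]])
  finally show ?thesis by (simp add: add_divide_distrib)
qed

lemma digit_val_diff:
  assumes "q > 1" "\<And>i. i < n \<Longrightarrow> d i = e i"
  shows "digit_val q d - digit_val q e =
    (digit_val q (\<lambda>i. d (i + n)) - digit_val q (\<lambda>i. e (i + n))) / q ^ n"
  using assms(2)
proof (induction n arbitrary: d e)
  case 0
  then show ?case by simp
next
  case (Suc n)
  have "digit_val q d - digit_val q e =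
      (digit_val q (\<lambda>n. d (Suc n)) - digit_val q (\<lambda>n. e (Suc n))) / q"
    using Suc.prems[of 0] digit_val_head[OF assms(1), of d] digit_val_head[OF assms(1), of e]
    by (simp flip: diff_divide_distrib)
  also have "digit_val q (\<lambda>n. d (Suc n)) - digit_val q (\<lambda>n. e (Suc n)) =
      (digit_val q (\<lambda>i. d (Suc (i + n))) - digit_val q (\<lambda>i. e (Suc (i + n)))) / q ^ n"
    using Suc.prems by (intro Suc.IH) auto
  finally show ?case by (simp add: mult.commute)
qed

lemma digit_val_diff_abs_le:
  assumes "q > 1" "\<And>i. i < n \<Longrightarrow> d i = e i"
  shows "\<bar>digit_val q d - digit_val q e\<bar> \<le> 1 / q ^ n"
proof -
  have "\<bar>digit_val q (\<lambda>i. d (i + n)) - digit_val q (\<lambda>i. e (i + n))\<bar> \<le> 1"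
    using digit_val_nonneg[OF assms(1)] digit_val_le_1[OF assms(1)]
    by (smt (verit))
  then show ?thesis
    using assms(1) digit_val_diff[OF assms] by (simp add: divide_right_mono)
qed

text \<open>After the common prefix, one value lies in the lowest and the other in the highest
  interval of length \<open>1 / q\<close>, with \<open>(q - 2) / q\<close> between them.\<close>

lemma digit_val_separated:
  assumes "q > 1" "\<And>i. i < n \<Longrightarrow> d i = e i" "d n \<noteq> e n"
  shows "(q - 2) / q ^ Suc n \<le> \<bar>digit_val q d - digit_val q e\<bar>"
proof -
  have gap: "(q - 2) / q \<le> \<bar>digit_val q d' - digit_val q e'\<bar>" if "d' 0 \<noteq> e' 0" for d' e'
  proof -
    let ?x = "digit_val q (\<lambda>n. d' (Suc n))" and ?y = "digit_val q (\<lambda>n. e' (Suc n))"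
    have "q - 2 \<le> \<bar>((q - 1) * of_bool (d' 0) + ?x) - ((q - 1) * of_bool (e' 0) + ?y)\<bar>"
      using that digit_val_nonneg[OF assms(1), of "\<lambda>n. d' (Suc n)"]
        digit_val_nonneg[OF assms(1), of "\<lambda>n. e' (Suc n)"]
        digit_val_le_1[OF assms(1), of "\<lambda>n. d' (Suc n)"]
        digit_val_le_1[OF assms(1), of "\<lambda>n. e' (Suc n)"]
      by (cases "d' 0"; cases "e' 0") auto
    then have "(q - 2) / q \<le> \<bar>((q - 1) * of_bool (d' 0) + ?x) - ((q - 1) * of_bool (e' 0) + ?y)\<bar> / q"
      using assms(1) by (intro divide_right_mono) auto
    also have "\<dots> = \<bar>digit_val q d' - digit_val q e'\<bar>"
      using assms(1)
      by (subst (3) digit_val_head, simp, subst (4) digit_val_head, simp)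
         (simp flip: diff_divide_distrib)
    finally show ?thesis .
  qed
  have "(q - 2) / q / q ^ n \<le>
      \<bar>digit_val q (\<lambda>i. d (i + n)) - digit_val q (\<lambda>i. e (i + n))\<bar> / q ^ n"
    using assms by (intro divide_right_mono gap) auto
  also have "\<dots> = \<bar>digit_val q d - digit_val q e\<bar>"
    using assms(1) digit_val_diff[of q n d e] assms(2) by simp
  finally show ?thesis by simp
qed

text \<open>By \<open>step\<close> each point has a digit and a successor in \<open>S\<close>.
  Iterating reads off all digits, with error at most \<open>1 / q ^ n\<close> after \<open>n\<close>
  of them.\<close>

lemma digit_val_surj:
  assumes q: "q > 1" and S: "S \<subseteq> {0..1}"
    and step: "\<And>x. x \<in> S \<Longrightarrow> \<exists>b. \<exists>y\<in>S. x = ((q - 1) * of_bool b + y) / q"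
    and "x \<in> S"
  obtains d where "digit_val q d = x"
proof -
  obtain b y where zoom: "\<And>x. x \<in> S \<Longrightarrow> y x \<in> S \<and> x = ((q - 1) * of_bool (b x) + y x) / q"
    using step by metis
  define X where "X n = (y ^^ n) x" for n
  define d where "d n = b (X n)" for n
  have X: "X n \<in> S" for n
    by (induction n) (use \<open>x \<in> S\<close> zoom in \<open>auto simp: X_def\<close>)
  have diff: "digit_val q d - x = (digit_val q (\<lambda>i. d (i + n)) - X n) / q ^ n" for n
  proof (induction n)
    case 0
    then show ?case by (simp add: X_def)
  next
    case (Suc n)
    have "X n = ((q - 1) * of_bool (d n) + X (Suc n)) / q"
      using zoom[OF X, of n] by (simp add: d_def X_def)
    then have "digit_val q (\<lambda>i. d (i + n)) - X n = (digit_val q (\<lambda>i. d (i + Suc n)) - X (Suc n)) / q"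
      using digit_val_head[OF q, of "\<lambda>i. d (i + n)"] by (simp flip: diff_divide_distrib)
    with Suc.IH show ?case by (simp add: mult.commute)
  qed
  have "\<bar>digit_val q d - x\<bar> \<le> (1 / q) ^ n" for n
  proof -
    have "X n \<in> {0..1}" using X S by blast
    then have "\<bar>digit_val q (\<lambda>i. d (i + n)) - X n\<bar> \<le> 1"
      using digit_val_nonneg[OF q, of "\<lambda>i. d (i + n)"] digit_val_le_1[OF q, of "\<lambda>i. d (i + n)"]
      by auto
    then show ?thesis using q by (simp add: diff[of n] power_divide divide_right_mono)
  qed
  moreover have "(\<lambda>n. (1 / q) ^ n) \<longlonglongrightarrow> 0" using q by (intro LIMSEQ_power_zero) simp
  ultimately have "\<bar>digit_val q d - x\<bar> \<le> 0" by (intro LIMSEQ_le_const[of _ 0]) auto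
  then show thesis using that by simp
qed

lemma binary_expansion:
  assumes "x \<in> {0..1}"
  obtains d where "digit_val 2 d = x"
proof (rule digit_val_surj[of 2 "{0..1}" x])
  fix x :: real assume x: "x \<in> {0..1}"
  show "\<exists>b. \<exists>y\<in>{0..1}. x = ((2 - 1) * of_bool b + y) / 2"
  proof (cases "x \<le> 1/2")
    case True
    with x show ?thesis by (intro exI[of _ False] bexI[of _ "2 * x"]) auto
  next
    case False
    with x show ?thesis by (intro exI[of _ True] bexI[of _ "2 * x - 1"]) auto
  qed
qed (use assms that in auto)

section \<open>The zero set for \<open>\<alpha> = -1\<close> as a Cantor set\<close>

text \<open>Multiplication by 4 shifts the digits up to an integer, and the leading digit places the
  value in the first or last quarter.\<close>

lemma digit_val_tent: "tent (4 ^ k * digit_val 4 d) \<le> 1/4"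
proof (induction k arbitrary: d)
  case 0
  have "digit_val 4 d = (3 * of_bool (d 0) + digit_val 4 (\<lambda>n. d (Suc n))) / 4"
    using digit_val_head[of 4 d] by simp
  then have "digit_val 4 d \<in> {0..1/4} \<union> {3/4..1}"
    using digit_val_nonneg[of 4 "\<lambda>n. d (Suc n)"] digit_val_le_1[of 4 "\<lambda>n. d (Suc n)"]
    by (cases "d 0") auto
  then show ?case
    using tent_le[of "digit_val 4 d" 0] tent_le[of "digit_val 4 d" 1] by auto
next
  case (Suc k)
  have "4 * digit_val 4 d = digit_val 4 (\<lambda>n. d (Suc n)) + 3 * of_bool (d 0)"
    using digit_val_head[of 4 d] by simp
  then have "4 ^ Suc k * digit_val 4 d =
      4 ^ k * digit_val 4 (\<lambda>n. d (Suc n)) + of_int (4 ^ k * 3 * of_bool (d 0))"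
    by (simp add: mult.assoc mult.left_commute[of 4] distrib_left)
  then show ?case using Suc.IH tent_add_int by metis
qed

lemma zero_set_eq_range:
  "{t \<in> {0..1}. \<forall>k. tent (4 ^ k * t) \<le> 1/4} = range (digit_val 4)" (is "?S = _")
proof (intro subset_antisym subsetI)
  fix t assume "t \<in> ?S"
  then show "t \<in> range (digit_val 4)"
  proof (rule digit_val_surj[of 4 ?S t, rotated 3])
    fix x assume x: "x \<in> ?S"
    \<comment> \<open>The condition for \<open>k\<close> at the image is the one for
      \<open>Suc k\<close> at \<open>x\<close>, since the removed digit contributes an
      integer.\<close>
    have step: "4 * x - 3 * of_bool b \<in> ?S" if "4 * x - 3 * of_bool b \<in> {0..1}" for b
    proof -
      have "4 ^ k * (4 * x - 3 * of_bool b) = 4 ^ Suc k * x + of_int (- (4 ^ k * 3 * of_bool b))" for k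
        by (simp add: algebra_simps)
      then have "tent (4 ^ k * (4 * x - 3 * of_bool b)) = tent (4 ^ Suc k * x)" for k
        using tent_add_int by metis
      moreover have "tent (4 ^ Suc k * x) \<le> 1/4" for k using x by blast
      ultimately show ?thesis using that by simp
    qed
    have "tent x \<le> 1/4" using x by (auto dest: spec[of _ 0])
    moreover have "tent x = (if x \<le> 1/2 then x else 1 - x)"
      using x tent_eq[of x 0] tent_eq[of x 1] by auto
    ultimately consider "x \<le> 1/4" | "3/4 \<le> x" by (auto split: if_splits)
    then obtain b where b: "4 * x - 3 * of_bool b \<in> {0..1}"
    proof cases
      case 1
      then show thesis using x that[of False] by auto
    next
      case 2
      then show thesis using x that[of True] by auto
    qed
    show "\<exists>b. \<exists>y\<in>?S. x = ((4 - 1) * of_bool b + y) / 4"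
      by (intro exI[of _ b] bexI[OF _ step[OF b]]) simp
  qed auto
next
  fix t :: real assume "t \<in> range (digit_val 4)"
  then show "t \<in> ?S"
    using digit_val_tent digit_val_nonneg digit_val_le_1 by auto
qed

text \<open>The sign -1 is the binary digit 1, so equal signs at \<open>2 * n\<close> and
  \<open>2 * n + 1\<close> form the block 00 or 11, the base-4 digit 0 or 3.\<close>

lemma rademacher_pair_sum:
  assumes "\<rho> (2 * n) = (if d then -1 else 1 :: real)" "\<rho> (2 * n + 1) = \<rho> (2 * n)"
  shows "(\<Sum>i = n * 2..<n * 2 + 2. 1 / 2 ^ (i + 2) * (1 - \<rho> i)) = (4 - 1) * of_bool d / 4 ^ Suc n"
proof -
  have "{n * 2..<n * 2 + 2} = {2 * n, 2 * n + 1}" by auto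
  moreover have "(2::real) ^ (2 * n) = 4 ^ n" by (simp add: power_mult)
  ultimately show ?thesis using assms by (simp add: power_add field_simps)
qed

lemma paired_rademacher_iff:
  "(\<exists>\<rho>. rademacher_expansion \<rho> t \<and> (\<forall>n. \<rho> (2 * n) = \<rho> (2 * n + 1))) \<longleftrightarrow> t \<in> range (digit_val 4)"
proof
  assume "\<exists>\<rho>. rademacher_expansion \<rho> t \<and> (\<forall>n. \<rho> (2 * n) = \<rho> (2 * n + 1))"
  then obtain \<rho> where \<rho>: "\<And>n. \<rho> n \<in> {-1, 1}" "(\<lambda>n. 1 / 2 ^ (n + 2) * (1 - \<rho> n)) sums t"
      "\<And>n. \<rho> (2 * n + 1) = \<rho> (2 * n)"
    unfolding rademacher_expansion_def by metis
  define d where "d n \<longleftrightarrow> \<rho> (2 * n) = -1" for n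
  have "(\<Sum>i = n * 2..<n * 2 + 2. 1 / 2 ^ (i + 2) * (1 - \<rho> i)) = (4 - 1) * of_bool (d n) / 4 ^ Suc n" for n
    using \<rho>(1)[of "2 * n"] \<rho>(3) by (intro rademacher_pair_sum) (auto simp: d_def)
  with sums_group[OF \<rho>(2), of 2] have "(\<lambda>n. (4 - 1) * of_bool (d n) / 4 ^ Suc n) sums t"
    by simp
  then show "t \<in> range (digit_val 4)"
    unfolding digit_val_def by (auto simp: sums_iff)
next
  assume "t \<in> range (digit_val 4)"
  then obtain d where d: "t = digit_val 4 d" by blast
  define \<rho> :: "nat \<Rightarrow> real" where "\<rho> n = (if d (n div 2) then -1 else 1)" for n
  let ?f = "\<lambda>n. 1 / 2 ^ (n + 2) * (1 - \<rho> n)"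
  \<comment> \<open>Grouping presupposes convergence, so this is settled first; the groups then
    identify the limit.\<close>
  have "summable (\<lambda>n. (1/2) ^ n :: real)" by (intro summable_geometric) simp
  then have "summable ?f"
    by (rule summable_comparison_test') (auto simp: \<rho>_def power_divide field_simps)
  then have sums: "?f sums suminf ?f" by (rule summable_sums)
  have "(\<Sum>i = n * 2..<n * 2 + 2. ?f i) = (4 - 1) * of_bool (d n) / 4 ^ Suc n" for n
    by (rule rademacher_pair_sum) (auto simp: \<rho>_def)
  with sums_group[OF sums, of 2] have "(\<lambda>n. (4 - 1) * of_bool (d n) / 4 ^ Suc n) sums suminf ?f"
    by simp
  then have "suminf ?f = t" unfolding d digit_val_def by (simp add: sums_iff)
  then have "rademacher_expansion \<rho> t"
    using sums by (auto simp: rademacher_expansion_def \<rho>_def)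
  then show "\<exists>\<rho>. rademacher_expansion \<rho> t \<and> (\<forall>n. \<rho> (2 * n) = \<rho> (2 * n + 1))"
    by (intro exI[of _ \<rho>]) (auto simp: \<rho>_def)
qed

text \<open>Flipping a far digit \<open>n\<close> moves the point by at most
  \<open>1 / q ^ n\<close>, and separation keeps the new point distinct.\<close>

lemma range_digit_val_not_isolated:
  assumes "q > 2"
  shows "\<not> x isolated_in range (digit_val q)"
proof
  assume "x isolated_in range (digit_val q)"
  then obtain d e where "e > 0" and iso: "\<And>y. y \<in> range (digit_val q) \<Longrightarrow> dist (digit_val q d) y < e \<Longrightarrow> y = digit_val q d"
    by (auto simp: isolated_in_dist_Ex_iff)
  obtain n where n: "(1 / q) ^ n < e"
    using real_arch_pow_inv[OF \<open>e > 0\<close>, of "1 / q"] assms by auto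
  define d' where "d' = d(n := \<not> d n)"
  have "\<bar>digit_val q d - digit_val q d'\<bar> \<le> 1 / q ^ n"
    using assms by (intro digit_val_diff_abs_le) (auto simp: d'_def)
  with n have "dist (digit_val q d) (digit_val q d') < e"
    by (simp add: dist_real_def power_divide)
  moreover have "0 < \<bar>digit_val q d - digit_val q d'\<bar>"
  proof (rule less_le_trans)
    show "0 < (q - 2) / q ^ Suc n" using assms by simp
    show "(q - 2) / q ^ Suc n \<le> \<bar>digit_val q d - digit_val q d'\<bar>"
      using assms by (intro digit_val_separated) (auto simp: d'_def)
  qed
  ultimately show False using iso[of "digit_val q d'"] by simp
qed

section \<open>Hausdorff measure\<close>

lemma hausdorff_premeasure_le_finite_cover:
  fixes A :: "real set"
  assumes "finite P" "card P \<le> N" "A \<subseteq> (\<Union>p\<in>P. {p..p + r})" "0 \<le> r" "r \<le> \<delta>" "0 < s"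
  shows "hausdorff_premeasure s \<delta> A \<le> ennreal (real N * r powr s)"
proof -
  obtain h where h: "bij_betw h {..<card P} P"
    using \<open>finite P\<close> bij_betw_from_nat_into_finite by blast
  \<comment> \<open>Empty sets cost 0 and pad the finite cover to a sequence.\<close>
  define U where "U i = (if i < card P then {h i..h i + r} else {})" for i
  have "diameter {p..p + r} \<le> r" for p
    using \<open>0 \<le> r\<close> by (intro diameter_le) auto
  then have small: "bounded (U i)" "diameter (U i) \<le> r" for i
    using \<open>0 \<le> r\<close> by (auto simp: U_def)
  have "A \<subseteq> (\<Union>i. U i)"
  proof
    fix x assume "x \<in> A"
    with assms(3) have "x \<in> (\<Union>p\<in>P. {p..p + r})" by (rule subsetD)
    then obtain p where "p \<in> P" "x \<in> {p..p + r}" by (rule UN_E)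
    moreover have "p \<in> h ` {..<card P}"
      using \<open>p \<in> P\<close> by (simp only: bij_betw_imp_surj_on[OF h])
    then obtain i where "i < card P" "h i = p" by auto
    ultimately show "x \<in> (\<Union>i. U i)" by (auto simp: U_def intro!: exI[of _ i])
  qed
  then have "hausdorff_premeasure s \<delta> A \<le> (\<Sum>i. diam_power s (U i))"
    unfolding hausdorff_premeasure_def using small \<open>r \<le> \<delta>\<close>
    by (intro INF_lower) (auto intro: order_trans)
  also have "\<dots> = (\<Sum>i<card P. diam_power s (U i))"
    by (rule suminf_finite) (auto simp: U_def diam_power_def)
  also have "\<dots> \<le> (\<Sum>i<card P. ennreal (r powr s))"
    using small diameter_ge_0 \<open>0 < s\<close>
    by (intro sum_mono) (auto simp: diam_power_def intro!: ennreal_leI powr_mono2)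
  also have "\<dots> = ennreal (real (card P) * r powr s)"
    by (simp add: ennreal_mult ennreal_of_nat_eq_real_of_nat)
  also have "\<dots> \<le> ennreal (real N * r powr s)"
    using assms(2) by (intro ennreal_leI mult_right_mono) auto
  finally show ?thesis .
qed

text \<open>The two contractions carry a cover of level \<open>n\<close> to one of level
  \<open>Suc n\<close>, with at most twice as many intervals, each shorter by the factor
  \<open>q\<close>.\<close>

lemma range_digit_val_cover:
  assumes "q > 1"
  shows "\<exists>P. finite P \<and> card P \<le> 2 ^ n \<and> range (digit_val q) \<subseteq> (\<Union>p\<in>P. {p..p + 1 / q ^ n})"
proof (induction n)
  case 0
  show ?case
    using digit_val_nonneg[OF assms] digit_val_le_1[OF assms]
    by (intro exI[of _ "{0}"]) auto
next
  case (Suc n)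
  then obtain P where P: "finite P" "card P \<le> 2 ^ n"
      "range (digit_val q) \<subseteq> (\<Union>p\<in>P. {p..p + 1 / q ^ n})"
    by blast
  let ?g = "\<lambda>b p. ((q - 1) * of_bool b + p) / q"
  let ?Q = "?g False ` P \<union> ?g True ` P"
  have "card ?Q \<le> card (?g False ` P) + card (?g True ` P)" by (rule card_Un_le)
  also have "\<dots> \<le> card P + card P" by (intro add_mono card_image_le P)
  also have "\<dots> \<le> 2 ^ Suc n" using P(2) by simp
  finally have "card ?Q \<le> 2 ^ Suc n" .
  moreover have "digit_val q d \<in> (\<Union>p\<in>?Q. {p..p + 1 / q ^ Suc n})" for d
  proof -
    let ?x = "digit_val q (\<lambda>n. d (Suc n))"
    obtain p where p: "p \<in> P" "p \<le> ?x" "?x \<le> p + 1 / q ^ n" using P(3) by fastforce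
    have "?g (d 0) p \<le> digit_val q d"
      using p assms by (subst digit_val_head) (auto intro!: divide_right_mono)
    moreover have "digit_val q d \<le> ((q - 1) * of_bool (d 0) + (p + 1 / q ^ n)) / q"
      using p assms by (subst digit_val_head) (auto intro!: divide_right_mono)
    moreover have "((q - 1) * of_bool (d 0) + (p + 1 / q ^ n)) / q = ?g (d 0) p + 1 / q ^ Suc n"
      by (simp add: add_divide_distrib mult.commute)
    ultimately have "digit_val q d \<in> {?g (d 0) p..?g (d 0) p + 1 / q ^ Suc n}" by simp
    moreover have "?g (d 0) p \<in> ?Q" using p by (cases "d 0") auto
    ultimately show ?thesis by blast
  qed
  then have "range (digit_val q) \<subseteq> (\<Union>p\<in>?Q. {p..p + 1 / q ^ Suc n})" by blast
  ultimately show ?case using P(1) by (intro exI[of _ ?Q]) blast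
qed

text \<open>The level-\<open>n\<close> cover costs at most
  \<open>2 ^ n * (1 / 4 ^ n) powr s\<close>. The exponent 1/2 is critical: the ratio is 1 there and
  below 1 for larger \<open>s\<close>.\<close>

lemma cantor_premeasure_le:
  assumes "1 / 4 ^ n \<le> \<delta>" "0 < s"
  shows "hausdorff_premeasure s \<delta> (range (digit_val 4)) \<le> ennreal ((2 powr (1 - 2 * s)) ^ n)"
proof -
  obtain P where P: "finite P" "card P \<le> 2 ^ n" "range (digit_val 4) \<subseteq> (\<Union>p\<in>P. {p..p + 1 / 4 ^ n})"
    using range_digit_val_cover[of 4 n] by auto
  have "hausdorff_premeasure s \<delta> (range (digit_val 4)) \<le> ennreal (real (2 ^ n) * (1 / 4 ^ n) powr s)"
    using P assms by (intro hausdorff_premeasure_le_finite_cover) auto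
  also have "real (2 ^ n) * (1 / 4 ^ n) powr s = (2 powr (1 - 2 * s)) ^ n"
  proof -
    have "(1 / 4 ^ n :: real) = (2 powr - 2) ^ n"
      by (simp add: powr_minus power_divide)
    also have "\<dots> powr s = (2 powr (- 2 * s)) ^ n"
      by (simp add: powr_powr powr_power mult_ac)
    finally have "2 ^ n * (1 / 4 ^ n) powr s = (2 * 2 powr (- 2 * s)) ^ n"
      by (simp add: power_mult_distrib)
    also have "2 * 2 powr (- 2 * s) = 2 powr (1 + - 2 * s)" by (simp only: powr_add) simp
    finally show ?thesis by simp
  qed
  finally show ?thesis .
qed

lemma inverse_power_le_obtain:
  fixes \<delta> :: real
  assumes "\<delta> > 0"
  obtains n where "\<And>m. n \<le> m \<Longrightarrow> 1 / 4 ^ m \<le> \<delta>"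
proof -
  obtain n where n: "(1/4) ^ n < \<delta>" using real_arch_pow_inv[OF assms, of "1/4"] by auto
  have "1 / 4 ^ m \<le> \<delta>" if "n \<le> m" for m
  proof -
    have "(1/4::real) ^ m \<le> (1/4) ^ n" using that by (intro power_decreasing) auto
    with n show ?thesis by (simp add: power_divide)
  qed
  with that show thesis by blast
qed

lemma cantor_measure_half_le_1: "hausdorff_measure (1/2) (range (digit_val 4)) \<le> 1"
  unfolding hausdorff_measure_def
proof (rule SUP_least)
  fix \<delta> :: real assume "\<delta> \<in> {0<..}"
  then obtain n where "1 / 4 ^ n \<le> \<delta>" using inverse_power_le_obtain[of \<delta>] by auto
  then show "hausdorff_premeasure (1/2) \<delta> (range (digit_val 4)) \<le> 1"
    using cantor_premeasure_le[of n \<delta> "1/2"] by simp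
qed

lemma cantor_measure_eq_0:
  assumes "s > 1/2"
  shows "hausdorff_measure s (range (digit_val 4)) = 0"
proof -
  have "hausdorff_premeasure s \<delta> (range (digit_val 4)) \<le> 0" if \<delta>: "\<delta> > 0" for \<delta>
  proof -
    obtain n where n: "\<And>m. n \<le> m \<Longrightarrow> 1 / 4 ^ m \<le> \<delta>"
      using inverse_power_le_obtain[OF \<delta>] by blast
    have "2 powr (1 - 2 * s) < (2::real) powr 0" using assms by (intro powr_less_mono) auto
    then have "(\<lambda>n. (2 powr (1 - 2 * s)) ^ n) \<longlonglongrightarrow> 0" by (intro LIMSEQ_power_zero) simp
    then have "(\<lambda>n. ennreal ((2 powr (1 - 2 * s)) ^ n)) \<longlonglongrightarrow> ennreal 0" by (intro tendsto_ennrealI)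
    moreover have "\<forall>m\<ge>n. hausdorff_premeasure s \<delta> (range (digit_val 4)) \<le> ennreal ((2 powr (1 - 2 * s)) ^ m)"
      using assms n by (auto intro: cantor_premeasure_le)
    ultimately show ?thesis by (intro LIMSEQ_le_const[where a = "hausdorff_premeasure s \<delta> (range (digit_val 4))"]) auto
  qed
  then have "hausdorff_measure s (range (digit_val 4)) \<le> 0"
    unfolding hausdorff_measure_def by (intro SUP_least) auto
  then show ?thesis by simp
qed

text \<open>The Cantor function, which re-reads the base-4 digits in base 2, is Hoelder continuous of
  exponent \<open>1/2\<close>.\<close>

lemma cantor_function_Hoelder:
  "\<bar>digit_val 2 d - digit_val 2 e\<bar> \<le> 2 * \<bar>digit_val 4 d - digit_val 4 e\<bar> powr (1/2)"
proof (cases "d = e")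
  case True
  then show ?thesis by simp
next
  case False
  \<comment> \<open>At the first differing digit, the base-2 values are at most
    \<open>1 / 2 ^ n\<close> apart and the base-4 values at least
    \<open>2 / 4 ^ Suc n\<close>.\<close>
  define n where "n = (LEAST n. d n \<noteq> e n)"
  have "\<exists>n. d n \<noteq> e n" using False by auto
  then have ne: "d n \<noteq> e n" unfolding n_def by (rule LeastI_ex)
  have eq: "d i = e i" if "i < n" for i using not_less_Least[of i "\<lambda>n. d n \<noteq> e n"] that by (auto simp: n_def)
  let ?\<Delta> = "\<bar>digit_val 4 d - digit_val 4 e\<bar>"
  have sep: "(4 - 2) / 4 ^ Suc n \<le> ?\<Delta>" by (rule digit_val_separated) (use ne eq in auto)
  have "(1 / 2 ^ n)\<^sup>2 = 1 / (4::real) ^ n"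
    by (simp add: power2_eq_square flip: power_mult_distrib)
  also have "\<dots> \<le> 4 * ((4 - 2) / 4 ^ Suc n)"
    by (simp add: divide_right_mono)
  also have "\<dots> \<le> 4 * ?\<Delta>" using sep by (intro mult_left_mono) auto
  finally have "(1 / 2 ^ n)\<^sup>2 \<le> 4 * ?\<Delta>" .
  then have "1 / 2 ^ n \<le> sqrt (4 * ?\<Delta>)" by (rule real_le_rsqrt)
  also have "sqrt (4 * ?\<Delta>) = 2 * ?\<Delta> powr (1/2)" by (simp add: real_sqrt_mult powr_half_sqrt)
  finally show ?thesis using digit_val_diff_abs_le[of 2 n d e] eq by simp
qed

text \<open>Intervals containing the images of the \<open>U i\<close> under the Cantor function
  cover the unit interval, so their lengths sum to at least 1. Diameters of at most 1 let the
  exponent 1/2 be lowered to \<open>s\<close>.\<close>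

lemma cantor_cover_lower_bound:
  fixes U :: "nat \<Rightarrow> real set"
  assumes s: "0 \<le> s" "s \<le> 1/2" and U: "\<And>i. bounded (U i)" "\<And>i. diameter (U i) \<le> 1"
    and cover: "range (digit_val 4) \<subseteq> (\<Union>i. U i)"
  shows "1 \<le> 4 * (\<Sum>i. diam_power s (U i))"
proof -
  define R where "R i = diameter (U i) powr (1/2)" for i
  \<comment> \<open>The image need not be measurable, so it is enclosed in a measurable
    \<open>J\<close>.\<close>
  have "\<exists>J. digit_val 2 ` (digit_val 4 -` U i) \<subseteq> J \<and> J \<in> sets lborel \<and>
      emeasure lborel J \<le> 4 * diam_power s (U i)" for i
  proof (cases "digit_val 4 -` U i = {}")
    case True
    then show ?thesis by (intro exI[of _ "{}"]) auto
  next
    case False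
    then obtain e where e: "digit_val 4 e \<in> U i" by auto
    \<comment> \<open>The radius uses the Hoelder constant 2 around one reference point; the length
      \<open>4 * R i\<close> explains the factor 4.\<close>
    let ?J = "{digit_val 2 e - 2 * R i..digit_val 2 e + 2 * R i}"
    have "digit_val 2 d \<in> ?J" if "digit_val 4 d \<in> U i" for d
    proof -
      have "\<bar>digit_val 4 d - digit_val 4 e\<bar> \<le> diameter (U i)"
        using diameter_bounded_bound[OF U(1) that e] by (simp add: dist_real_def)
      then have "\<bar>digit_val 4 d - digit_val 4 e\<bar> powr (1/2) \<le> R i"
        unfolding R_def by (intro powr_mono2) auto
      then show ?thesis using cantor_function_Hoelder[of d e] by (auto simp: abs_le_iff)
    qed
    moreover have "emeasure lborel ?J \<le> 4 * diam_power s (U i)"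
    proof -
      have "emeasure lborel ?J = ennreal (4 * R i)" by (simp add: R_def)
      also have "\<dots> = 4 * ennreal (R i)" by (simp add: ennreal_mult R_def)
      also have "ennreal (R i) \<le> diam_power s (U i)"
      \<comment> \<open>For \<open>s = 0\<close> the nonempty set costs 1 by convention, even at
        diameter 0.\<close>
      proof (cases "s = 0")
        case True
        then show ?thesis
          using e U diameter_ge_0[OF U(1)] by (auto simp: diam_power_def R_def powr_le1)
      next
        case False
        then show ?thesis
          using e s U diameter_ge_0[OF U(1)]
          by (auto simp: diam_power_def R_def intro!: ennreal_leI powr_mono')
      qed
      finally show ?thesis by (simp add: mult_left_mono)
    qed
    ultimately show ?thesis by (intro exI[of _ ?J]) auto
  qed
  then obtain J where J: "\<And>i. digit_val 2 ` (digit_val 4 -` U i) \<subseteq> J i"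
      "\<And>i. J i \<in> sets lborel" "\<And>i. emeasure lborel (J i) \<le> 4 * diam_power s (U i)"
    by metis
  have "{0..1} \<subseteq> (\<Union>i. J i)"
  proof
    fix x :: real assume "x \<in> {0..1}"
    then obtain d where d: "digit_val 2 d = x" by (rule binary_expansion)
    obtain i where "digit_val 4 d \<in> U i" using cover by blast
    then show "x \<in> (\<Union>i. J i)" using J(1)[of i] d by blast
  qed
  moreover have "(\<Union>i. J i) \<in> sets lborel" using J(2) by blast
  ultimately have "emeasure lborel {0..1::real} \<le> emeasure lborel (\<Union>i. J i)"
    by (rule emeasure_mono)
  also have "\<dots> \<le> (\<Sum>i. emeasure lborel (J i))"
    using J(2) by (intro emeasure_subadditive_countably) auto
  also have "\<dots> \<le> (\<Sum>i. 4 * diam_power s (U i))"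
    by (intro suminf_le J(3)) auto
  finally show ?thesis by simp
qed

text \<open>The measure is a supremum over scales, so a lower bound at scale 1 suffices.\<close>

lemma cantor_measure_pos:
  assumes "0 \<le> s" "s \<le> 1/2"
  shows "0 < hausdorff_measure s (range (digit_val 4))"
proof -
  have "1 / 4 \<le> hausdorff_premeasure s 1 (range (digit_val 4))"
    unfolding hausdorff_premeasure_def
  proof (rule INF_greatest, clarify)
    fix U :: "nat \<Rightarrow> real set"
    assume "\<forall>i. bounded (U i) \<and> diameter (U i) \<le> 1" "range (digit_val 4) \<subseteq> (\<Union>i. U i)"
    then have "1 \<le> 4 * (\<Sum>i. diam_power s (U i))"
      using assms by (intro cantor_cover_lower_bound) auto
    then show "1 / 4 \<le> (\<Sum>i. diam_power s (U i))"
      by (simp add: divide_le_posI_ennreal)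
  qed
  also have "\<dots> \<le> hausdorff_measure s (range (digit_val 4))"
    unfolding hausdorff_measure_def by (rule SUP_upper) simp
  finally show ?thesis by (rule less_le_trans[rotated]) (simp add: ennreal_zero_less_divide)
qed

text \<open>The measure is positive at 1/2, so the infimum is not attained and is approached through
  \<open>1/2 + e\<close>.\<close>

lemma cantor_hausdorff_dim: "hausdorff_dim (range (digit_val 4)) = ennreal (1/2)"
  unfolding hausdorff_dim_def
proof (rule antisym)
  let ?Z = "{s. 0 \<le> s \<and> hausdorff_measure s (range (digit_val 4)) = 0}"
  show "ennreal (1/2) \<le> (INF s\<in>?Z. ennreal s)"
  proof (rule INF_greatest)
    fix s assume "s \<in> ?Z"
    then have "\<not> s \<le> 1/2" using cantor_measure_pos[of s] by auto
    then show "ennreal (1/2) \<le> ennreal s" by (intro ennreal_leI) simp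
  qed
  show "(INF s\<in>?Z. ennreal s) \<le> ennreal (1/2)"
  proof (rule ennreal_le_epsilon)
    fix e :: real assume "0 < e"
    then have "1/2 + e \<in> ?Z" using cantor_measure_eq_0[of "1/2 + e"] by simp
    then have "(INF s\<in>?Z. ennreal s) \<le> ennreal (1/2 + e)" by (rule INF_lower)
    then show "(INF s\<in>?Z. ennreal s) \<le> ennreal (1/2) + ennreal e"
      using \<open>0 < e\<close> by (simp add: ennreal_plus)
  qed
qed

section \<open>Assembly of the three parameter ranges\<close>

theorem theorem3p13:
  shows
    "(\<forall>\<alpha> \<in> {-2<..<-1}.
        minimizers (takagi \<alpha>) {0..1} \<inter> {0..1/2} = {1/5} \<and>
        is_minimum_value (takagi \<alpha>) {0..1} (takagi \<alpha> (1/5)) \<and>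
        takagi \<alpha> (1/5) = (1 + \<alpha>) / (5 * (1 - (\<alpha> / 2)\<^sup>2)))
     \<and>
     (is_minimum_value (takagi (-1)) {0..1} 0 \<and>
      minimizers (takagi (-1)) {0..1} =
        {t \<in> {0..1}. \<exists>\<rho>. rademacher_expansion \<rho> t \<and> (\<forall>n. \<rho> (2 * n) = \<rho> (2 * n + 1))} \<and>
      perfect_set (minimizers (takagi (-1)) {0..1}) \<and>
      hausdorff_dim (minimizers (takagi (-1)) {0..1}) = ennreal (1/2) \<and>
      0 < hausdorff_measure (1/2) (minimizers (takagi (-1)) {0..1}) \<and>
      hausdorff_measure (1/2) (minimizers (takagi (-1)) {0..1}) < \<infinity>)
     \<and>
     (\<forall>\<alpha> \<in> {-1<..<2}.
        minimizers (takagi \<alpha>) {0..1} \<inter> {0..1/2} = {0} \<and>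
        is_minimum_value (takagi \<alpha>) {0..1} (takagi \<alpha> 0) \<and>
        takagi \<alpha> 0 = 0)"
proof (intro conjI ballI)
  fix \<alpha> :: real assume \<alpha>: "\<alpha> \<in> {-2<..<-1}"
  then have \<alpha>': "\<alpha> \<in> {-2<..<2}" by auto
  obtain m where m: "m \<in> {0..1/2}" "\<And>s. s \<in> {0..1} \<Longrightarrow> takagi \<alpha> m \<le> takagi \<alpha> s"
    using takagi_minimum_attained[OF \<alpha>'] by blast
  \<comment> \<open>The digit argument only locates minimizers. Applied to the one that compactness
    provides, it shows that 1/5 is a global minimizer.\<close>
  then have "m = 1/5" by (rule takagi_minimizer_eq_fifth[OF \<alpha>])
  with m have min: "\<And>s. s \<in> {0..1} \<Longrightarrow> takagi \<alpha> (1/5) \<le> takagi \<alpha> s" by simp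
  show "minimizers (takagi \<alpha>) {0..1} \<inter> {0..1/2} = {1/5}"
    using takagi_minimizer_eq_fifth[OF \<alpha>] min by (auto simp: mem_minimizers_iff)
  show "is_minimum_value (takagi \<alpha>) {0..1} (takagi \<alpha> (1/5))"
    using min by (auto simp: is_minimum_value_def)
  show "takagi \<alpha> (1/5) = (1 + \<alpha>) / (5 * (1 - (\<alpha> / 2)\<^sup>2))"
    by (rule takagi_fifth[OF \<alpha>'])
next
  have nonneg: "0 \<le> takagi (-1) t" for t by (rule takagi_nonneg) simp
  show "is_minimum_value (takagi (-1)) {0..1} 0"
    using nonneg takagi_0[of "-1"] by (auto simp: is_minimum_value_def image_iff intro!: bexI[of _ 0])
  have "(\<forall>s\<in>{0..1}. takagi (-1) t \<le> takagi (-1) s) \<longleftrightarrow> takagi (-1) t = 0" for t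
  proof
    assume "\<forall>s\<in>{0..1}. takagi (-1) t \<le> takagi (-1) s"
    then have "takagi (-1) t \<le> takagi (-1) 0" by (rule bspec) simp
    then show "takagi (-1) t = 0" using nonneg[of t] by (simp add: takagi_0)
  qed (use nonneg in simp)
  then have zeros: "minimizers (takagi (-1)) {0..1} = {t \<in> {0..1}. takagi (-1) t = 0}"
    by (simp add: set_eq_iff mem_minimizers_iff)
  then have cantor: "minimizers (takagi (-1)) {0..1} = range (digit_val 4)"
    using zero_set_eq_range by (simp add: takagi_minus_one_eq_0_iff)
  have "range (digit_val 4) \<subseteq> {0..1}"
    using digit_val_nonneg digit_val_le_1 by auto
  then show "minimizers (takagi (-1)) {0..1} =
        {t \<in> {0..1}. \<exists>\<rho>. rademacher_expansion \<rho> t \<and> (\<forall>n. \<rho> (2 * n) = \<rho> (2 * n + 1))}"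
    unfolding cantor paired_rademacher_iff by blast
  \<comment> \<open>Closedness comes from continuity rather than from the digit description.\<close>
  have "closed {t \<in> {0..1}. takagi (-1) t = 0}"
    using continuous_on_subset[OF continuous_on_takagi[of "-1"]]
    by (intro continuous_closed_preimage_constant) auto
  then show "perfect_set (minimizers (takagi (-1)) {0..1})"
    using range_digit_val_not_isolated[of 4] unfolding perfect_set_def zeros[symmetric] by (simp add: cantor)
  show "hausdorff_dim (minimizers (takagi (-1)) {0..1}) = ennreal (1/2)"
    unfolding cantor by (rule cantor_hausdorff_dim)
  show "0 < hausdorff_measure (1/2) (minimizers (takagi (-1)) {0..1})"
    unfolding cantor by (rule cantor_measure_pos) auto
  show "hausdorff_measure (1/2) (minimizers (takagi (-1)) {0..1}) < \<infinity>"
    unfolding cantor using cantor_measure_half_le_1 by (rule le_less_trans) simp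
next
  fix \<alpha> :: real assume \<alpha>: "\<alpha> \<in> {-1<..<2}"
  then have nonneg: "0 \<le> takagi \<alpha> t" for t by (intro takagi_nonneg) auto
  have "t = 0" if "t \<in> minimizers (takagi \<alpha>) {0..1}" "t \<in> {0..1/2}" for t
  proof (rule ccontr)
    assume "t \<noteq> 0"
    then have "0 < takagi \<alpha> t" using that(2) by (intro takagi_pos[OF \<alpha>]) auto
    moreover have "takagi \<alpha> t \<le> takagi \<alpha> 0" using that(1) by (auto simp: mem_minimizers_iff)
    ultimately show False by (simp add: takagi_0)
  qed
  then show "minimizers (takagi \<alpha>) {0..1} \<inter> {0..1/2} = {0}"
    using nonneg by (auto simp: mem_minimizers_iff takagi_0)
  show "is_minimum_value (takagi \<alpha>) {0..1} (takagi \<alpha> 0)"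
    using nonneg by (auto simp: is_minimum_value_def takagi_0 image_iff intro!: bexI[of _ 0])
  show "takagi \<alpha> 0 = 0" by (rule takagi_0)
qed

end
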